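(* Let $X$ be a real Hilbert space, let $T\colon X\to X$ be quasi nonexpansive and fixed-point closed, let $x_0\in X$, and set $C_0:=X$. Given $n\in\mathbb N$ and $x_n$, set $$C_{n+1}:=C_n\cap H(x_n,Tx_n)\quad\text{and}\quad x_{n+1}=P_{C_{n+1}}x_0,$$ the latter being defined only when $C_{n+1}\neq\varnothing$. Then exactly one of the following holds: (i) $\operatorname{Fix}T\neq\varnothing$, the sequence $(x_n)_{n\in\mathbb N}$ is well defined, and $x_n\to P_{\operatorname{Fix}T}x_0$ in norm; (ii) $\operatorname{Fix}T=\varnothing$, the sequence $(x_n)_{n\in\mathbb N}$ is well defined, and $\|x_n\|\to+\infty$; (iii) $\operatorname{Fix}T=\varnothing$ and the sequence is not well defined, i.e., $C_{n+1}=\varnothing$ for some $n\in\mathbb N$.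
   Context: $\mathbb N=\{0,1,2,\dots\}$. $\operatorname{Fix}T:=\{x\in X: x=Tx\}$. $T$ is quasi nonexpansive if $\|Tx-y\|\le\|x-y\|$ for all $x\in X$ and all $y\in\operatorname{Fix}T$ (so this holds vacuously if $\operatorname{Fix}T=\varnothing$); no continuity is assumed. $T$ is fixed-point closed if, for every sequence $(z_n)_{n\in\mathbb N}$ in $X$ and every $\bar x\in X$, $z_n\to\bar x$ and $z_n-Tz_n\to0$ (both in norm) imply $\bar x\in\operatorname{Fix}T$. For $x,y\in X$, $H(x,y):=\{z\in X:\|y-z\|\le\|x-z\|\}$, which is $X$ if $x=y$ and a closed halfspace otherwise. For a nonempty closed convex set $D\subseteq X$, $P_Dx$ denotes the unique point of $D$ nearest to $x$. (The fixed point set of a quasi nonexpansive map on $X$ is closed and convex, so $P_{\operatorname{Fix}T}$ makes sense when $\operatorname{Fix}T\ne\varnothing$.) The sequence $(x_n)_{n\in\mathbb N}$ is well defined if all the sets $C_n$ produced by the recursion are nonempty. *)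

theory Defs
  imports "HOL-Analysis.Analysis"
begin

definition Fix :: "('a \<Rightarrow> 'a) \<Rightarrow> 'a set"
  where "Fix T = {x. x = T x}"

definition quasi_nonexpansive :: "('a::real_normed_vector \<Rightarrow> 'a) \<Rightarrow> bool"
  where "quasi_nonexpansive T \<longleftrightarrow> (\<forall>x. \<forall>y\<in>Fix T. norm (T x - y) \<le> norm (x - y))"

definition fixed_point_closed :: "('a::real_normed_vector \<Rightarrow> 'a) \<Rightarrow> bool"
  where "fixed_point_closed T \<longleftrightarrow>
    (\<forall>(z :: nat \<Rightarrow> 'a) xbar. z \<longlonglongrightarrow> xbar \<longrightarrow> (\<lambda>n. z n - T (z n)) \<longlonglongrightarrow> 0 \<longrightarrow> xbar \<in> Fix T)"

definition H :: "'a::real_normed_vector \<Rightarrow> 'a \<Rightarrow> 'a set"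
  where "H x y = {z. norm (y - z) \<le> norm (x - z)}"

(* The library's closest_point is restricted to class heine_borel, i.e. to finite dimension.
   The value is meaningful only when a unique nearest point exists, e.g. for nonempty closed
   convex D in a Hilbert space. *)
definition proj :: "'a::real_normed_vector set \<Rightarrow> 'a \<Rightarrow> 'a"
  where "proj D x = (THE p. p \<in> D \<and> (\<forall>q\<in>D. norm (x - p) \<le> norm (x - q)))"

(* The recursion as a pair of total functions. If C_seq T x0 (Suc n) = {}, then
   x_seq T x0 (Suc n) is an arbitrary junk value; all later sets C_seq are then empty as well,
   so the junk cannot influence whether the sequence is well defined. *)
fun C_seq :: "('a::real_normed_vector \<Rightarrow> 'a) \<Rightarrow> 'a \<Rightarrow> nat \<Rightarrow> 'a set"
  and x_seq :: "('a \<Rightarrow> 'a) \<Rightarrow> 'a \<Rightarrow> nat \<Rightarrow> 'a"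
  where
    "C_seq T x0 0 = UNIV"
  | "C_seq T x0 (Suc n) = C_seq T x0 n \<inter> H (x_seq T x0 n) (T (x_seq T x0 n))"
  | "x_seq T x0 0 = x0"
  | "x_seq T x0 (Suc n) = proj (C_seq T x0 (Suc n)) x0"

definition seq_well_defined :: "('a::real_normed_vector \<Rightarrow> 'a) \<Rightarrow> 'a \<Rightarrow> bool"
  where "seq_well_defined T x0 \<longleftrightarrow> (\<forall>n. C_seq T x0 n \<noteq> {})"

lemma not_seq_well_defined_iff:
  "\<not> seq_well_defined T x0 \<longleftrightarrow> (\<exists>n. C_seq T x0 (Suc n) = {})"
  unfolding seq_well_defined_def by (metis C_seq.simps(1) UNIV_not_empty not0_implies_Suc)

definition exactly_one_of :: "bool \<Rightarrow> bool \<Rightarrow> bool \<Rightarrow> bool"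
  where "exactly_one_of P Q R \<longleftrightarrow> (P \<or> Q \<or> R) \<and> \<not> (P \<and> Q) \<and> \<not> (P \<and> R) \<and> \<not> (Q \<and> R)"

end

theory Submission
  imports Defs
begin

text \<open>
  Every \<^term>\<open>C_seq T x0 n\<close> is an intersection of sets \<^term>\<open>H x (T x)\<close>, each a closed halfspace or
  the whole space; hence it is closed and convex, and it contains
  \<^term>\<open>Fix T\<close> because quasi nonexpansiveness says exactly \<^term>\<open>Fix T \<subseteq> H x (T x)\<close> for every \<open>x\<close>.
  So the iterates can only break down when \<open>T\<close> has no fixed points.

  Suppose that all \<^term>\<open>C_seq T x0 n\<close> are nonempty. Since these sets shrink, the distances
  \<open>\<parallel>x0 - x\<^sub>n\<parallel>\<close> increase. The parallelogram law bounds \<open>\<parallel>x\<^sub>m - x\<^sub>n\<parallel>\<^sup>2\<close> by the growth of the squared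
  distances between \<open>n\<close> and \<open>m\<close> (lemma \<open>dist_nearest_sq_le\<close>). If the distances are bounded they
  converge, so \<open>x\<^sub>n\<close>
  is Cauchy; as \<open>x\<^sub>n\<^sub>+\<^sub>1\<close> lies in \<open>H x\<^sub>n (T x\<^sub>n)\<close>, the point \<open>T x\<^sub>n\<close> is no farther from \<open>x\<^sub>n\<^sub>+\<^sub>1\<close> than
  \<open>x\<^sub>n\<close> is, whence \<open>x\<^sub>n - T x\<^sub>n \<rightarrow> 0\<close> and the limit is a fixed point (lemma
  \<open>convergent_to_fixed_point\<close>). This yields the dichotomy. Without fixed points the monotone
  distances must tend to infinity. With a fixed point \<open>y\<close> the distances are bounded by \<open>\<parallel>x0 - y\<parallel>\<close>,
  because \<open>y\<close> belongs to every \<^term>\<open>C_seq T x0 n\<close>; letting \<open>n \<rightarrow> \<infinity>\<close> in the parallelogram bound for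
  \<open>y\<close> and \<open>x\<^sub>n\<close> identifies the limit as the unique fixed point nearest to \<open>x0\<close>.
\<close>

section \<open>Nearest points in complete inner product spaces\<close>

text \<open>
  The parallelogram law for \<open>x - p\<close> and \<open>x - q\<close>: their half sum is \<open>x\<close> minus the midpoint of
  \<open>p\<close> and \<open>q\<close>, which convexity keeps in \<open>D\<close> and therefore at distance at least \<open>d\<close> from \<open>x\<close>.
  Existence and uniqueness of nearest points and the convergence of the iterates all rest on this
  bound.
\<close>

lemma parallelogram_near_minimal:
  fixes x :: "'a::real_inner"
  assumes "convex D" "p \<in> D" "q \<in> D" "0 \<le> d" and d: "\<And>z. z \<in> D \<Longrightarrow> d \<le> norm (x - z)"
  shows "(norm (p - q))\<^sup>2 \<le> 2 * ((norm (x - p))\<^sup>2 - d\<^sup>2) + 2 * ((norm (x - q))\<^sup>2 - d\<^sup>2)"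
proof -
  define m where "m = (1/2) *\<^sub>R p + (1/2) *\<^sub>R q"
  have "m \<in> D"
    unfolding m_def using assms(1-3) by (intro convexD) auto
  then have "d\<^sup>2 \<le> (norm (x - m))\<^sup>2"
    using d \<open>0 \<le> d\<close> by (intro power_mono) auto
  moreover have "(norm (p - q))\<^sup>2
      = 2 * (norm (x - p))\<^sup>2 + 2 * (norm (x - q))\<^sup>2 - 4 * (norm (x - m))\<^sup>2"
    unfolding m_def power2_norm_eq_inner
    by (simp add: inner_diff_left inner_diff_right inner_add_left inner_add_right
        inner_commute[of p x] inner_commute[of q x] inner_commute[of q p] algebra_simps)
  ultimately show ?thesis by simp
qed

lemma dist_nearest_sq_le:
  fixes x :: "'a::real_inner"
  assumes "convex D" "p \<in> D" "q \<in> D" and "\<And>z. z \<in> D \<Longrightarrow> norm (x - p) \<le> norm (x - z)"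
  shows "(norm (q - p))\<^sup>2 \<le> 2 * ((norm (x - q))\<^sup>2 - (norm (x - p))\<^sup>2)"
  using parallelogram_near_minimal[of D q p "norm (x - p)" x] assms by auto

lemma Cauchy_if_norm_sq_le:
  fixes u :: "nat \<Rightarrow> 'a::real_normed_vector" and e :: "nat \<Rightarrow> real"
  assumes "e \<longlonglongrightarrow> 0" and le: "\<And>m n. n \<le> m \<Longrightarrow> (norm (u m - u n))\<^sup>2 \<le> e m + e n"
  shows "Cauchy u"
proof (rule metric_CauchyI)
  fix \<epsilon> :: real assume "0 < \<epsilon>"
  then have "0 < \<epsilon>\<^sup>2 / 2" by simp
  with \<open>e \<longlonglongrightarrow> 0\<close> have "\<forall>\<^sub>F n in sequentially. e n < \<epsilon>\<^sup>2 / 2"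
    by (rule order_tendstoD)
  then obtain N where N: "\<And>n. N \<le> n \<Longrightarrow> e n < \<epsilon>\<^sup>2 / 2"
    by (auto simp: eventually_sequentially)
  have close: "dist (u m) (u n) < \<epsilon>" if "N \<le> n" "n \<le> m" for m n
  proof -
    have "(dist (u m) (u n))\<^sup>2 < \<epsilon>\<^sup>2"
      using le[OF \<open>n \<le> m\<close>] N[of m] N[of n] that by (simp add: dist_norm)
    then show ?thesis
      using \<open>0 < \<epsilon>\<close> by (simp add: power_less_imp_less_base)
  qed
  have "dist (u m) (u n) < \<epsilon>" if "N \<le> m" "N \<le> n" for m n
    using close[of n m] close[of m n] that by (metis dist_commute nle_le)
  then show "\<exists>M. \<forall>m\<ge>M. \<forall>n\<ge>M. dist (u m) (u n) < \<epsilon>" by blast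
qed

lemma nearest_point_exists:
  fixes x :: "'a::{real_inner, complete_space}"
  assumes "convex D" "closed D" "D \<noteq> {}"
  obtains p where "p \<in> D" "\<And>z. z \<in> D \<Longrightarrow> norm (x - p) \<le> norm (x - z)"
proof -
  define d where "d = infdist x D"
  have d: "d \<le> norm (x - z)" if "z \<in> D" for z
    using infdist_le[OF that, of x] by (simp add: d_def dist_norm)
  have "0 \<le> d" by (simp add: d_def infdist_nonneg)
  have "\<exists>z\<in>D. dist x z < d + inverse (real (Suc n))" for n
    using \<open>D \<noteq> {}\<close> cINF_less_iff[of D "dist x" "d + inverse (real (Suc n))"]
    by (simp add: d_def infdist_notempty bdd_belowI2[of _ 0])
  then obtain q where q: "\<And>n. q n \<in> D" "\<And>n. norm (x - q n) < d + inverse (real (Suc n))"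
    unfolding dist_norm by metis
  have lim: "(\<lambda>n. norm (x - q n)) \<longlonglongrightarrow> d"
  proof (rule tendsto_sandwich[where f = "\<lambda>_. d"])
    show "(\<lambda>n. d + inverse (real (Suc n))) \<longlonglongrightarrow> d"
      using tendsto_add[OF tendsto_const LIMSEQ_inverse_real_of_nat, of d] by simp
    show "\<forall>\<^sub>F n in sequentially. norm (x - q n) \<le> d + inverse (real (Suc n))"
      using q(2) by (intro always_eventually allI less_imp_le)
  qed (use d[OF q(1)] in simp_all)
  have "Cauchy q"
  proof (rule Cauchy_if_norm_sq_le)
    show "(\<lambda>n. 2 * ((norm (x - q n))\<^sup>2 - d\<^sup>2)) \<longlonglongrightarrow> 0"
      using tendsto_mult[OF tendsto_const[of 2] tendsto_diff[OF tendsto_power[OF lim, of 2] tendsto_const[of "d\<^sup>2"]]]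
      by simp
    show "(norm (q m - q n))\<^sup>2 \<le> 2 * ((norm (x - q m))\<^sup>2 - d\<^sup>2) + 2 * ((norm (x - q n))\<^sup>2 - d\<^sup>2)"
      for m n
      using parallelogram_near_minimal[OF \<open>convex D\<close> q(1) q(1) \<open>0 \<le> d\<close> d] .
  qed
  then obtain p where p: "q \<longlonglongrightarrow> p"
    using Cauchy_convergent_iff convergent_def by blast
  have "p \<in> D"
    using closed_sequentially[OF \<open>closed D\<close> _ p] q(1) by blast
  moreover have "norm (x - p) = d"
    using LIMSEQ_unique[OF tendsto_norm[OF tendsto_diff[OF tendsto_const p]] lim] .
  ultimately show thesis
    using d that by blast
qed

text \<open>
  The quadratic gap makes \<open>p\<close> the only minimiser of the distance to \<open>x\<close>. This form serves for \<^term>\<open>Fix T\<close>, where the gap is inherited from the larger convex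
  sets of the recursion.
\<close>

lemma proj_eqI:
  fixes x :: "'a::real_inner"
  assumes "p \<in> D"
    and gap: "\<And>q. q \<in> D \<Longrightarrow> (norm (q - p))\<^sup>2 \<le> 2 * ((norm (x - q))\<^sup>2 - (norm (x - p))\<^sup>2)"
  shows "proj D x = p"
  unfolding proj_def
proof (rule the_equality)
  show "p \<in> D \<and> (\<forall>q\<in>D. norm (x - p) \<le> norm (x - q))"
  proof (intro conjI ballI)
    fix q assume "q \<in> D"
    then have "(norm (x - p))\<^sup>2 \<le> (norm (x - q))\<^sup>2"
      using order_trans[OF zero_le_power2 gap] by fastforce
    then show "norm (x - p) \<le> norm (x - q)"
      by (rule power2_le_imp_le) simp
  qed fact
next
  fix r assume r: "r \<in> D \<and> (\<forall>q\<in>D. norm (x - r) \<le> norm (x - q))"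
  then have "2 * ((norm (x - r))\<^sup>2 - (norm (x - p))\<^sup>2) \<le> 0"
    using \<open>p \<in> D\<close> by (simp add: power_mono)
  then have "(norm (r - p))\<^sup>2 \<le> 0"
    using gap[of r] r order_trans by blast
  then show "r = p" by simp
qed

lemma proj_nearest:
  fixes x :: "'a::{real_inner, complete_space}"
  assumes "convex D" "closed D" "D \<noteq> {}"
  shows "proj D x \<in> D" and "z \<in> D \<Longrightarrow> norm (x - proj D x) \<le> norm (x - z)"
proof -
  obtain p where p: "p \<in> D" "\<And>z. z \<in> D \<Longrightarrow> norm (x - p) \<le> norm (x - z)"
    using nearest_point_exists[OF assms] by blast
  then have "proj D x = p"
    using dist_nearest_sq_le[OF assms(1) p(1) _ p(2)] by (intro proj_eqI)
  then show "proj D x \<in> D" and "z \<in> D \<Longrightarrow> norm (x - proj D x) \<le> norm (x - z)"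
    using p by auto
qed

section \<open>The shrinking sets and their iterates\<close>

text \<open>Squaring both norms cancels \<open>\<parallel>z\<parallel>\<^sup>2\<close> and leaves an affine inequality in \<open>z\<close>.\<close>

lemma H_halfspace:
  fixes x y :: "'a::real_inner"
  shows "H x y = {z. inner (x - y) z \<le> ((norm x)\<^sup>2 - (norm y)\<^sup>2) / 2}"
proof -
  have "norm (y - z) \<le> norm (x - z) \<longleftrightarrow> inner (x - y) z \<le> ((norm x)\<^sup>2 - (norm y)\<^sup>2) / 2" for z
    unfolding norm_le power2_norm_eq_inner
    by (simp add: inner_diff_left inner_diff_right inner_commute[of z x] inner_commute[of z y] field_simps)
  then show ?thesis by (simp add: H_def)
qed

lemma C_seq_convex_closed:
  fixes T :: "'a::real_inner \<Rightarrow> 'a"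
  shows "convex (C_seq T x0 n) \<and> closed (C_seq T x0 n)"
proof (induction n)
  case (Suc n)
  then show ?case
    by (auto intro!: convex_Int closed_Int simp only: C_seq.simps H_halfspace
        convex_halfspace_le closed_halfspace_le)
qed simp

lemma Fix_subset_C_seq:
  assumes "quasi_nonexpansive T"
  shows "Fix T \<subseteq> C_seq T x0 n"
  using assms by (induction n) (auto simp: quasi_nonexpansive_def H_def)

lemma C_seq_antimono: "m \<le> n \<Longrightarrow> C_seq T x0 n \<subseteq> C_seq T x0 m"
  by (rule lift_Suc_antimono_le[of "C_seq T x0"]) auto

lemma x_seq_nearest:
  fixes T :: "'a::{real_inner, complete_space} \<Rightarrow> 'a"
  assumes "seq_well_defined T x0"
  shows "x_seq T x0 n \<in> C_seq T x0 n"
    and "z \<in> C_seq T x0 n \<Longrightarrow> norm (x0 - x_seq T x0 n) \<le> norm (x0 - z)"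
proof -
  have "C_seq T x0 n \<noteq> {}"
    using assms by (simp add: seq_well_defined_def)
  note near = proj_nearest[OF conjunct1[OF C_seq_convex_closed] conjunct2[OF C_seq_convex_closed] this]
  show "x_seq T x0 n \<in> C_seq T x0 n"
    using near(1) by (cases n) (simp_all del: C_seq.simps(2))
  show "norm (x0 - x_seq T x0 n) \<le> norm (x0 - z)" if "z \<in> C_seq T x0 n"
    using near(2)[OF that] by (cases n) (simp_all del: C_seq.simps(2))
qed

lemma x_seq_gap:
  fixes T :: "'a::{real_inner, complete_space} \<Rightarrow> 'a"
  assumes "seq_well_defined T x0" "z \<in> C_seq T x0 n"
  shows "(norm (z - x_seq T x0 n))\<^sup>2 \<le> 2 * ((norm (x0 - z))\<^sup>2 - (norm (x0 - x_seq T x0 n))\<^sup>2)"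
  by (rule dist_nearest_sq_le[OF conjunct1[OF C_seq_convex_closed] x_seq_nearest(1)[OF assms(1)]
        assms(2) x_seq_nearest(2)[OF assms(1)]])

lemma x_seq_dist_mono:
  fixes T :: "'a::{real_inner, complete_space} \<Rightarrow> 'a"
  assumes "seq_well_defined T x0"
  shows "mono (\<lambda>n. norm (x0 - x_seq T x0 n))"
  using x_seq_nearest[OF assms] C_seq_antimono by (intro monoI) blast

section \<open>Bounded iterates converge to a fixed point\<close>

text \<open>
  Boundedness turns the increasing distances to \<open>x0\<close> into a convergent sequence, and the gap between
  their squares controls the distance between iterates.
\<close>

lemma x_seq_convergent:
  fixes T :: "'a::{real_inner, complete_space} \<Rightarrow> 'a"
  assumes wd: "seq_well_defined T x0" and bound: "\<And>n. norm (x0 - x_seq T x0 n) \<le> B"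
  shows "convergent (x_seq T x0)"
proof -
  define s where "s n = (norm (x0 - x_seq T x0 n))\<^sup>2" for n
  have "incseq s"
    using x_seq_dist_mono[OF wd] by (auto simp: s_def mono_def intro!: power_mono)
  moreover have "s n \<le> B\<^sup>2" for n
    using bound by (auto simp: s_def intro!: power_mono)
  ultimately obtain l where l: "s \<longlonglongrightarrow> l" "\<And>n. s n \<le> l"
    using incseq_convergent[of s "B\<^sup>2"] by blast
  \<comment> \<open>As \<open>s m \<le> l\<close>, the gap \<open>2 * (s m - s n)\<close> is at most \<open>2 * (l - s n)\<close>.\<close>
  have "Cauchy (x_seq T x0)"
  proof (rule Cauchy_if_norm_sq_le)
    show "(\<lambda>n. 2 * (l - s n)) \<longlonglongrightarrow> 0"
      using tendsto_mult[OF tendsto_const[of 2] tendsto_diff[OF tendsto_const[of l] l(1)]] by simp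
    show "(norm (x_seq T x0 m - x_seq T x0 n))\<^sup>2 \<le> 2 * (l - s m) + 2 * (l - s n)" if "n \<le> m" for m n
    proof -
      have "x_seq T x0 m \<in> C_seq T x0 n"
        using C_seq_antimono[OF that] x_seq_nearest(1)[OF wd] by blast
      from x_seq_gap[OF wd this] show ?thesis
        using l(2)[of m] by (simp add: s_def)
    qed
  qed
  then show ?thesis by (simp add: Cauchy_convergent_iff)
qed

text \<open>
  Membership of \<open>x\<^sub>n\<^sub>+\<^sub>1\<close> in \<open>H x\<^sub>n (T x\<^sub>n)\<close> and the triangle inequality through \<open>x\<^sub>n\<^sub>+\<^sub>1\<close> give
  \<open>\<parallel>x\<^sub>n - T x\<^sub>n\<parallel> \<le> 2 \<parallel>x\<^sub>n - x\<^sub>n\<^sub>+\<^sub>1\<parallel>\<close>.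
\<close>

lemma convergent_to_fixed_point:
  fixes T :: "'a::{real_inner, complete_space} \<Rightarrow> 'a"
  assumes "fixed_point_closed T" and wd: "seq_well_defined T x0" and lim: "x_seq T x0 \<longlonglongrightarrow> p"
  shows "p \<in> Fix T"
proof -
  let ?x = "x_seq T x0"
  have le: "norm (?x n - T (?x n)) \<le> 2 * norm (?x n - ?x (Suc n))" for n
  proof -
    have "?x (Suc n) \<in> H (?x n) (T (?x n))"
      using x_seq_nearest(1)[OF wd, of "Suc n"] by simp
    then have "norm (T (?x n) - ?x (Suc n)) \<le> norm (?x n - ?x (Suc n))"
      by (simp add: H_def)
    then show ?thesis
      using norm_triangle_ineq4[of "?x n - ?x (Suc n)" "T (?x n) - ?x (Suc n)"] by simp
  qed
  have "(\<lambda>n. 2 * norm (?x n - ?x (Suc n))) \<longlonglongrightarrow> 0"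
    using tendsto_mult[OF tendsto_const[of 2] tendsto_norm[OF tendsto_diff[OF lim LIMSEQ_Suc[OF lim]]]]
    by simp
  then have "(\<lambda>n. ?x n - T (?x n)) \<longlonglongrightarrow> 0"
    by (rule Lim_null_comparison[OF always_eventually[OF allI[OF le]]])
  then show ?thesis
    using assms(1) lim unfolding fixed_point_closed_def by blast
qed

section \<open>The trichotomy\<close>

lemma x_seq_tendsto_proj_Fix:
  fixes T :: "'a::{real_inner, complete_space} \<Rightarrow> 'a"
  assumes qne: "quasi_nonexpansive T" and fpc: "fixed_point_closed T" and "Fix T \<noteq> {}"
  shows "seq_well_defined T x0" and "x_seq T x0 \<longlonglongrightarrow> proj (Fix T) x0"
proof -
  have sub: "y \<in> C_seq T x0 n" if "y \<in> Fix T" for y n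
    using Fix_subset_C_seq[OF qne] that by blast
  show wd: "seq_well_defined T x0"
    using sub \<open>Fix T \<noteq> {}\<close> unfolding seq_well_defined_def by blast
  obtain y where "y \<in> Fix T"
    using \<open>Fix T \<noteq> {}\<close> by blast
  then have "convergent (x_seq T x0)"
    using x_seq_convergent[OF wd, of "norm (x0 - y)"] x_seq_nearest(2)[OF wd sub] by blast
  then obtain p where p: "x_seq T x0 \<longlonglongrightarrow> p"
    by (auto simp: convergent_def)
  have "proj (Fix T) x0 = p"
  proof (rule proj_eqI)
    show "p \<in> Fix T"
      using convergent_to_fixed_point[OF fpc wd p] .
    fix q assume "q \<in> Fix T"
    show "(norm (q - p))\<^sup>2 \<le> 2 * ((norm (x0 - q))\<^sup>2 - (norm (x0 - p))\<^sup>2)"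
    proof (rule LIMSEQ_le)
      show "(\<lambda>n. (norm (q - x_seq T x0 n))\<^sup>2) \<longlonglongrightarrow> (norm (q - p))\<^sup>2"
        by (intro tendsto_intros p)
      show "(\<lambda>n. 2 * ((norm (x0 - q))\<^sup>2 - (norm (x0 - x_seq T x0 n))\<^sup>2))
          \<longlonglongrightarrow> 2 * ((norm (x0 - q))\<^sup>2 - (norm (x0 - p))\<^sup>2)"
        by (intro tendsto_intros p)
    qed (use x_seq_gap[OF wd sub[OF \<open>q \<in> Fix T\<close>]] in blast)
  qed
  with p show "x_seq T x0 \<longlonglongrightarrow> proj (Fix T) x0" by simp
qed

text \<open>
  Bounded iterates would converge to a fixed point. So the distances to \<open>x0\<close> exceed every bound at
  some index, and by monotonicity at all later ones.
\<close>

lemma x_seq_norm_at_top: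
  fixes T :: "'a::{real_inner, complete_space} \<Rightarrow> 'a"
  assumes fpc: "fixed_point_closed T" and "Fix T = {}" and wd: "seq_well_defined T x0"
  shows "filterlim (\<lambda>n. norm (x_seq T x0 n)) at_top sequentially"
  unfolding filterlim_at_top
proof
  fix B :: real
  have "\<not> convergent (x_seq T x0)"
    using convergent_to_fixed_point[OF fpc wd] \<open>Fix T = {}\<close> by (auto simp: convergent_def)
  then obtain N where N: "B + norm x0 < norm (x0 - x_seq T x0 N)"
    using x_seq_convergent[OF wd, of "B + norm x0"] by (meson not_less)
  have "B \<le> norm (x_seq T x0 n)" if "N \<le> n" for n
    using N monoD[OF x_seq_dist_mono[OF wd] that] norm_triangle_ineq4[of x0 "x_seq T x0 n"]
    by linarith
  then show "\<forall>\<^sub>F n in sequentially. B \<le> norm (x_seq T x0 n)"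
    by (auto simp: eventually_sequentially)
qed

theorem theorem2p3:
  fixes T :: "'a::{real_inner, complete_space} \<Rightarrow> 'a" and x0 :: 'a
  assumes "quasi_nonexpansive T" and "fixed_point_closed T"
  shows "exactly_one_of
    (Fix T \<noteq> {} \<and> seq_well_defined T x0 \<and> x_seq T x0 \<longlonglongrightarrow> proj (Fix T) x0)
    (Fix T = {} \<and> seq_well_defined T x0 \<and> filterlim (\<lambda>n. norm (x_seq T x0 n)) at_top sequentially)
    (Fix T = {} \<and> \<not> seq_well_defined T x0 \<and> (\<exists>n. C_seq T x0 (Suc n) = {}))"
  using x_seq_tendsto_proj_Fix[OF assms] x_seq_norm_at_top[OF assms(2)]
    not_seq_well_defined_iff[of T x0]
  unfolding exactly_one_of_def by blast

end
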